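(* Let $A$ be a real $m\times m$ matrix such that the Jacobian determinant of $F_A:\mathbb{R}^m\to\mathbb{R}^m$, $F_A(x)=x+(Ax)^3$, is nowhere zero on $\mathbb{R}^m$. Then $F_A$ is invertible (bijective as a map $\mathbb{R}^m\to\mathbb{R}^m$) if one of the following conditions is satisfied: (1) $\mathrm{Ker}(A)\subset \mathrm{Ker}(AA^T)$ (this holds for example when $A$ is invertible, symmetric or anti-symmetric). (2) $AA^T$ has rank $1$. (3) $A$ is an upper or lower triangular matrix. (4) The map $F_B(x)=x+(Bx)^3$ is proper, where $B=DAD^{-3}$ for an invertible diagonal real matrix $D$. (5) There is a vector $\zeta=(\zeta_1,\ldots,\zeta_m)$ with $\zeta_i>0$ for all $i$ such that $\langle A(x^3),\zeta*x\rangle\geq 0$ for all $x\in\mathrm{Im}(AA^T)$. (6) $\mathrm{Ker}(A)$ is generated by the vector $x_\infty=(1,\ldots,1)$ and $x_\infty\notin \mathrm{Im}(AA^T)\cap\mathrm{Im}(AAA^T)$. Moreover, if (5) holds then $F_A$ is proper, and if (5) holds with a vector $\zeta$ for which in addition $\langle A(x^3),\zeta*x\rangle\neq 0$ for all $0\neq x\in\mathrm{Im}(AA^T)$, then the map $F_{-A}(x)=x-(Ax)^3$ is also proper.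
   Context: For $x,y\in\mathbb{R}^m$, $x*y=(x_1y_1,\ldots,x_my_m)$ is the coordinatewise product and $x^3=x*x*x$. $\langle\cdot,\cdot\rangle$ is the usual inner product on $\mathbb{R}^m$. $A^T$ is the transpose of $A$, $\mathrm{Ker}(A)=\{x:Ax=0\}$, $\mathrm{Im}(A)=A(\mathbb{R}^m)$. A map is proper if preimages of compact sets are compact. *)

theory Defs
  imports "HOL-Analysis.Analysis"
begin

text \<open>
  On \<open>real^'n\<close> the library operations \<open>x * y\<close>, \<open>x ^ 3\<close> and \<open>1\<close> are coordinatewise, so \<open>1\<close> is
  the vector \<open>(1, \<dots>, 1)\<close>. On matrices they are entrywise too, so products of matrices
  are always written with \<open>**\<close>.
\<close>

definition cubic_map :: "real^'n^'n \<Rightarrow> real^'n \<Rightarrow> real^'n" where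
  "cubic_map A x = x + (A *v x) ^ 3"

definition mat_ker :: "real^'n^'m \<Rightarrow> (real^'n) set" where
  "mat_ker A = {x. A *v x = 0}"

definition mat_im :: "real^'n^'m \<Rightarrow> (real^'m) set" where
  "mat_im A = range (\<lambda>x. A *v x)"

definition proper_fun :: "('a::topological_space \<Rightarrow> 'b::topological_space) \<Rightarrow> bool" where
  "proper_fun f \<longleftrightarrow> (\<forall>K. compact K \<longrightarrow> compact (f -` K))"

definition diagonal_matrix :: "real^'n^'n \<Rightarrow> bool" where
  "diagonal_matrix D \<longleftrightarrow> (\<forall>i j. i \<noteq> j \<longrightarrow> D $ i $ j = 0)"

text \<open>Triangularity refers to the order of the finite index type, as in the library's
  \<open>det_upperdiagonal\<close>.\<close>

definition upper_triangular_matrix :: "real^('n::{finite,wellorder})^('n::{finite,wellorder}) \<Rightarrow> bool" where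
  "upper_triangular_matrix A \<longleftrightarrow> (\<forall>i j. j < i \<longrightarrow> A $ i $ j = 0)"

definition lower_triangular_matrix :: "real^('n::{finite,wellorder})^('n::{finite,wellorder}) \<Rightarrow> bool" where
  "lower_triangular_matrix A \<longleftrightarrow> (\<forall>i j. i < j \<longrightarrow> A $ i $ j = 0)"

definition weighted_cubic_nonneg :: "real^'n^'n \<Rightarrow> real^'n \<Rightarrow> bool" where
  "weighted_cubic_nonneg A \<zeta> \<longleftrightarrow>
     (\<forall>i. \<zeta> $ i > 0) \<and>
     (\<forall>x \<in> mat_im (A ** transpose A). (A *v (x ^ 3)) \<bullet> (\<zeta> * x) \<ge> 0)"

end

theory Submission
  imports Defs
begin

text \<open>
  A proper, locally injective map of Euclidean space with one value that is taken only once is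
  bijective, so everything reduces to showing that \<open>F\<^sub>A\<close> is proper. If \<open>F\<^sub>A\<close> is not proper, there
  are \<open>x\<^sub>n\<close> with \<open>F\<^sub>A(x\<^sub>n)\<close> bounded and \<open>u\<^sub>n = A x\<^sub>n\<close> unbounded; applying \<open>A\<close> to
  \<open>x\<^sub>n + u\<^sub>n\<^sup>3 = F\<^sub>A(x\<^sub>n)\<close> shows that a limit \<open>w\<close> of \<open>u\<^sub>n / |u\<^sub>n|\<close> is a unit vector in \<open>Im A = Im (AA\<^sup>T)\<close>
  with \<open>A(w\<^sup>3) = 0\<close>. Conditions (1), (5) and (6) rule this out, (2) is a case of (5), (4) is
  the identity \<open>F\<^sub>B(D\<^sup>3x) = D\<^sup>3F\<^sub>A(x)\<close>, and in (3) the coordinates are bounded one after the other.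
\<close>

section \<open>The cubic map and its Jacobian\<close>

lemma vec_power_nth: "((x::real^'n) ^ k) $ i = (x $ i) ^ k"
  by (induction k) auto

lemma cubic_map_nth: "cubic_map A x $ i = x $ i + ((A *v x) $ i) ^ 3"
  by (simp add: cubic_map_def vec_power_nth)

lemma continuous_on_cubic_map: "continuous_on S (cubic_map A)"
proof -
  have "cubic_map A = (\<lambda>x. \<chi> i. x $ i + ((A *v x) $ i) ^ 3)"
    by (simp add: fun_eq_iff vec_eq_iff cubic_map_nth)
  then show ?thesis
    by (simp add: continuous_intros)
qed

lemma jacobian_cubic_map:
  "jacobian (cubic_map A) (at x) =
     (\<chi> i j. (if i = j then 1 else 0) + 3 * ((A *v x) $ i)\<^sup>2 * A $ i $ j)"
proof -
  have nth: "((\<lambda>x. (A *v x) $ i) has_derivative (\<lambda>h. (A *v h) $ i)) (at x)" for i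
    by (intro bounded_linear_imp_has_derivative bounded_linear_compose[OF bounded_linear_vec_nth]
        matrix_vector_mul_bounded_linear)
  have "((\<lambda>x. cubic_map A x $ i) has_derivative
      (\<lambda>h. h $ i + 3 * ((A *v x) $ i)\<^sup>2 * (A *v h) $ i)) (at x)" for i
    unfolding cubic_map_nth
    by (auto intro!: derivative_eq_intros nth bounded_linear_imp_has_derivative[OF bounded_linear_vec_nth]
        simp: algebra_simps)
  then have "(cubic_map A has_derivative
      (\<lambda>h. \<chi> i. h $ i + 3 * ((A *v x) $ i)\<^sup>2 * (A *v h) $ i)) (at x)"
    by (subst has_derivative_componentwise_within) (auto simp: Basis_vec_def inner_axis)
  then show ?thesis
    by (simp add: jacobian_def frechet_derivative_at[symmetric] matrix_def vec_eq_iff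
        matrix_vector_mult_def axis_def if_distrib cong: if_cong)
qed

text \<open>The \<open>i\<close>-th expression is coordinate i of the Jacobian matrix at
  \<open>x\<close> applied to \<open>h\<close>, so this is injectivity of every derivative. In this
  form it can be tested on explicit vectors and on limits of sequences without determinants.\<close>

definition nondegenerate :: "real^'n^'n \<Rightarrow> bool" where
  "nondegenerate A \<longleftrightarrow>
     (\<forall>x h. (\<forall>i. h $ i + 3 * ((A *v x) $ i)\<^sup>2 * (A *v h) $ i = 0) \<longrightarrow> h = 0)"

lemma nondegenerate_if_det_jacobian:
  assumes "\<forall>x. det (jacobian (cubic_map A) (at x)) \<noteq> 0"
  shows "nondegenerate A"
  unfolding nondegenerate_def
proof (intro allI impI)
  fix x h
  assume h: "\<forall>i. h $ i + 3 * ((A *v x) $ i)\<^sup>2 * (A *v h) $ i = 0"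
  have "(jacobian (cubic_map A) (at x) *v h) $ i = h $ i + 3 * ((A *v x) $ i)\<^sup>2 * (A *v h) $ i" for i
    unfolding jacobian_cubic_map
    by (simp add: matrix_vector_mult_def distrib_right sum.distrib sum_distrib_left mult.assoc
        if_distrib[of "\<lambda>c. c * _"] cong: if_cong)
  then have "jacobian (cubic_map A) (at x) *v h = 0"
    using h by (simp add: vec_eq_iff)
  moreover have "invertible (jacobian (cubic_map A) (at x))"
    using assms invertible_det_nz by blast
  ultimately show "h = 0"
    by (metis invertible_def matrix_left_invertible_ker)
qed

section \<open>Local injectivity and the fibre over 0\<close>

text \<open>Factoring a^3 - b^3 coordinatewise. When \<open>x\<close> and \<open>y\<close> tend to
  the same p, the quadratic factor tends to 3 (A p)_i^2, the weight in the Jacobian at p.\<close>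

lemma cubic_map_diff_nth:
  "cubic_map A x $ i - cubic_map A y $ i =
     (x - y) $ i + (((A *v x) $ i)\<^sup>2 + (A *v x) $ i * (A *v y) $ i + ((A *v y) $ i)\<^sup>2) * (A *v (x - y)) $ i"
  by (simp add: cubic_map_nth matrix_vector_mult_diff_distrib power2_eq_square power3_eq_cube algebra_simps)

text \<open>The Jacobian at \<open>x / \<surd>3\<close> maps \<open>x\<close> to the value of the cubic map at \<open>x\<close>.\<close>

lemma cubic_map_eq_0_iff:
  assumes "nondegenerate A"
  shows "cubic_map A x = 0 \<longleftrightarrow> x = 0"
proof
  assume F: "cubic_map A x = 0"
  have "A *v ((1 / sqrt 3) *\<^sub>R x) = (1 / sqrt 3) *\<^sub>R (A *v x)"
    by (rule matrix_vector_mult_scaleR)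
  then have "x $ i + 3 * ((A *v ((1 / sqrt 3) *\<^sub>R x)) $ i)\<^sup>2 * (A *v x) $ i = cubic_map A x $ i" for i
    by (simp add: cubic_map_nth power_divide power2_eq_square power3_eq_cube)
  then show "x = 0"
    using assms F unfolding nondegenerate_def by (metis zero_index)
next
  assume "x = 0"
  then show "cubic_map A x = 0"
    by (simp add: cubic_map_def)
qed

text \<open>The unit secant directions of colliding pairs subconverge to a unit vector in the kernel
  of the Jacobian at \<open>p\<close>. This is local injectivity in the sequential form that
  \<open>proper_locally_injective_imp_bij\<close> expects.\<close>

lemma nondegenerate_no_collision:
  assumes A: "nondegenerate A"
    and x: "x \<longlonglongrightarrow> p" and y: "y \<longlonglongrightarrow> p"
    and neq: "\<And>n. x n \<noteq> y n" and eq: "\<And>n. cubic_map A (x n) = cubic_map A (y n)"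
  shows False
proof -
  define h where "h n = sgn (x n - y n)" for n :: nat
  have norm_h: "h n \<in> sphere 0 1" for n
    using neq by (simp add: h_def norm_sgn)
  have "compact (sphere (0::real^'a) 1)"
    by simp
  then obtain l r where l: "l \<in> sphere 0 1" and r: "strict_mono r" and lim: "(h \<circ> r) \<longlonglongrightarrow> l"
    using norm_h unfolding compact_def by metis
  define Q where "Q n i = ((A *v x n) $ i)\<^sup>2 + (A *v x n) $ i * (A *v y n) $ i + ((A *v y n) $ i)\<^sup>2" for n i
  \<comment> \<open>This is \<open>cubic_map_diff_nth\<close> divided by the distance of the two
    points; the difference of values there is 0.\<close>
  have h_eq: "h n $ i + Q n i * (A *v h n) $ i = 0" for n i
  proof -
    define c d where "c = inverse (norm (x n - y n))" and "d = x n - y n"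
    have "h n $ i = c * d $ i" "(A *v h n) $ i = c * (A *v d) $ i"
      by (simp_all add: h_def c_def d_def sgn_div_norm matrix_vector_mult_scaleR)
    then have "h n $ i + Q n i * (A *v h n) $ i = c * (cubic_map A (x n) $ i - cubic_map A (y n) $ i)"
      unfolding cubic_map_diff_nth Q_def d_def[symmetric] by (simp add: algebra_simps)
    then show ?thesis
      using eq by simp
  qed
  have lin: "(\<lambda>n. (A *v z n) $ i) \<longlonglongrightarrow> (A *v a) $ i" if "z \<longlonglongrightarrow> a" for z a i
    by (intro tendsto_vec_nth bounded_linear.tendsto[OF matrix_vector_mul_bounded_linear] that)
  have Q: "(\<lambda>n. Q (r n) i) \<longlonglongrightarrow> 3 * ((A *v p) $ i)\<^sup>2" for i
  proof -
    have "(\<lambda>n. Q n i) \<longlonglongrightarrow> ((A *v p) $ i)\<^sup>2 + (A *v p) $ i * (A *v p) $ i + ((A *v p) $ i)\<^sup>2"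
      unfolding Q_def by (intro tendsto_intros lin x y)
    then show ?thesis
      using LIMSEQ_subseq_LIMSEQ[OF _ r] by (fastforce simp: o_def power2_eq_square)
  qed
  have "l $ i + 3 * ((A *v p) $ i)\<^sup>2 * (A *v l) $ i = 0" for i
  proof -
    have "(\<lambda>n. h (r n) $ i + Q (r n) i * (A *v h (r n)) $ i)
        \<longlonglongrightarrow> l $ i + 3 * ((A *v p) $ i)\<^sup>2 * (A *v l) $ i"
      using lim by (intro tendsto_intros lin Q tendsto_vec_nth) (simp_all add: o_def)
    then show ?thesis
      unfolding h_eq by (simp add: LIMSEQ_const_iff)
  qed
  then have "l = 0"
    using A unfolding nondegenerate_def by blast
  then show False
    using l by simp
qed

section \<open>Proper, locally injective maps of Euclidean space\<close>

text \<open>A convergent sequence together with its limit is compact, so its preimage is a compact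
  set containing all \<open>x n\<close>; continuity identifies the value at a subsequential
  limit.\<close>

lemma proper_fun_subseq:
  fixes f :: "'a::metric_space \<Rightarrow> 'b::heine_borel"
  assumes "proper_fun f" and f: "continuous_on UNIV f" and lim: "(\<lambda>n. f (x n)) \<longlonglongrightarrow> q"
  obtains r l where "strict_mono r" "(x \<circ> r) \<longlonglongrightarrow> l" "f l = q"
proof -
  have "compact (f -` insert q (range (\<lambda>n. f (x n))))"
    using assms compact_sequence_with_limit[OF lim] by (simp add: proper_fun_def)
  then obtain l r where r: "strict_mono r" "(x \<circ> r) \<longlonglongrightarrow> l"
    unfolding compact_def by (metis insertI2 rangeI vimageI)
  have "isCont f l"
    using f by (simp add: continuous_on_eq_continuous_at)
  then have "(\<lambda>n. f ((x \<circ> r) n)) \<longlonglongrightarrow> f l"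
    using r(2) by (rule isCont_tendsto_compose)
  moreover have "(\<lambda>n. f ((x \<circ> r) n)) \<longlonglongrightarrow> q"
    using LIMSEQ_subseq_LIMSEQ[OF lim r(1)] by (simp add: o_def)
  ultimately have "f l = q"
    by (rule LIMSEQ_unique)
  with r show thesis
    using that by blast
qed

text \<open>A special case of Hadamard's global inverse function theorem: the set of points with at
  least two preimages is open and closed, and it misses \<open>f a\<close>.\<close>

lemma proper_locally_injective_imp_bij:
  fixes f :: "'a::euclidean_space \<Rightarrow> 'a"
  assumes f: "continuous_on UNIV f" and proper: "proper_fun f"
    and no_collision: "\<And>p x y. \<lbrakk>x \<longlonglongrightarrow> p; y \<longlonglongrightarrow> p; \<And>n::nat. x n \<noteq> y n; \<And>n. f (x n) = f (y n)\<rbrakk> \<Longrightarrow> False"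
    and unique: "\<And>x. f x = f a \<Longrightarrow> x = a"
  shows "bij f"
proof -
  have loc_inj: "\<exists>e>0. inj_on f (ball p e)" for p
  proof (rule ccontr)
    assume contr: "\<not> ?thesis"
    have "\<exists>x y. x \<in> ball p (1 / Suc n) \<and> y \<in> ball p (1 / Suc n) \<and> x \<noteq> y \<and> f x = f y" for n
      using contr unfolding inj_on_def by (metis of_nat_0_less_iff zero_less_Suc zero_less_divide_1_iff)
    then obtain x y where xy: "\<And>n. x n \<in> ball p (1 / Suc n)" "\<And>n. y n \<in> ball p (1 / Suc n)"
      "\<And>n. x n \<noteq> y n" "\<And>n. f (x n) = f (y n)"
      by metis
    have "z \<longlonglongrightarrow> p" if "\<And>n. z n \<in> ball p (1 / Suc n)" for z
    proof -
      have "eventually (\<lambda>n. norm (dist (z n) p) \<le> inverse (real (Suc n))) sequentially"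
        using that by (auto simp: dist_commute less_imp_le inverse_eq_divide)
      then have "(\<lambda>n. dist (z n) p) \<longlonglongrightarrow> 0"
        by (rule Lim_null_comparison[OF _ LIMSEQ_inverse_real_of_nat])
      then show ?thesis
        by (rule tendsto_dist_iff[THEN iffD2])
    qed
    then show False
      using no_collision xy by blast
  qed
  \<comment> \<open>Invariance of domain on a small ball about each point of
    \<open>U\<close>.\<close>
  have open_image: "open (f ` U)" if "open U" for U
  proof (subst open_subopen, safe)
    fix x assume "x \<in> U"
    obtain e where "e > 0" and inj: "inj_on f (ball x e)"
      using loc_inj by blast
    have "open (f ` (U \<inter> ball x e))"
      using that by (intro invariance_of_domain continuous_on_subset[OF f] inj_on_subset[OF inj]) auto
    moreover have "f x \<in> f ` (U \<inter> ball x e)"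
      using \<open>x \<in> U\<close> \<open>e > 0\<close> by (intro imageI) simp
    ultimately show "\<exists>T. open T \<and> f x \<in> T \<and> T \<subseteq> f ` U"
      by (meson Int_lower1 image_mono)
  qed
  have "closed (range f)"
    unfolding closed_sequential_limits
  proof safe
    fix q and s :: "nat \<Rightarrow> 'a"
    assume s: "\<forall>n. s n \<in> range f" and lim: "s \<longlonglongrightarrow> q"
    define x where "x n = inv f (s n)" for n
    have "(\<lambda>n. f (x n)) \<longlonglongrightarrow> q"
      using s lim by (simp add: x_def f_inv_into_f)
    then obtain r l where "f l = q"
      by (rule proper_fun_subseq[OF proper f])
    then show "q \<in> range f"
      by blast
  qed
  then have surj: "range f = UNIV"
    using clopen[of "range f"] open_image[of UNIV] by auto
  define N where "N = {q. \<exists>x y. x \<noteq> y \<and> f x = q \<and> f y = q}"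
  have "open N"
  proof (subst open_subopen, safe)
    fix q assume "q \<in> N"
    then obtain x y where xy: "x \<noteq> y" "f x = q" "f y = q"
      by (auto simp: N_def)
    then obtain U V where UV: "open U" "open V" "x \<in> U" "y \<in> V" "U \<inter> V = {}"
      by (metis hausdorff)
    \<comment> \<open>Disjoint neighbourhoods of two preimages have open images, and every point
      common to both images again has two preimages.\<close>
    have "f ` U \<inter> f ` V \<subseteq> N"
    proof
      fix z assume "z \<in> f ` U \<inter> f ` V"
      then obtain b c where "b \<in> U" "c \<in> V" "f b = z" "f c = z"
        by (metis IntE imageE)
      moreover have "b \<noteq> c"
        using UV(5) calculation by blast
      ultimately show "z \<in> N"
        unfolding N_def by blast
    qed
    moreover have "open (f ` U \<inter> f ` V)"
      using UV by (intro open_Int open_image)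
    moreover have "q \<in> f ` U \<inter> f ` V"
      using UV(3,4) xy(2,3) by (metis IntI imageI)
    ultimately show "\<exists>T. open T \<and> q \<in> T \<and> T \<subseteq> N"
      by blast
  qed
  moreover have "closed N"
    unfolding closed_sequential_limits
  proof safe
    fix q and s :: "nat \<Rightarrow> 'a"
    assume s: "\<forall>n. s n \<in> N" and lim: "s \<longlonglongrightarrow> q"
    have "\<forall>n. \<exists>x y. x \<noteq> y \<and> f x = s n \<and> f y = s n"
      using s by (simp add: N_def)
    then obtain x y where xy: "\<And>n. x n \<noteq> y n" "\<And>n. f (x n) = s n" "\<And>n. f (y n) = s n"
      by metis
    from lim have "(\<lambda>n. f (x n)) \<longlonglongrightarrow> q"
      by (simp add: xy)
    then obtain r l where r: "strict_mono r" "(x \<circ> r) \<longlonglongrightarrow> l" "f l = q"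
      by (rule proper_fun_subseq[OF proper f])
    have "(\<lambda>n. f ((y \<circ> r) n)) \<longlonglongrightarrow> q"
      using LIMSEQ_subseq_LIMSEQ[OF lim r(1)] by (simp add: xy o_def)
    then obtain r' l' where r': "strict_mono r'" "(y \<circ> r \<circ> r') \<longlonglongrightarrow> l'" "f l' = q"
      by (rule proper_fun_subseq[OF proper f])
    have "(x \<circ> r \<circ> r') \<longlonglongrightarrow> l"
      using LIMSEQ_subseq_LIMSEQ[OF r(2) r'(1)] .
    \<comment> \<open>Along the subsequences the two preimages of each value stay distinct, so a
      common limit would be a collision.\<close>
    then have "l \<noteq> l'"
      using no_collision[of "x \<circ> r \<circ> r'" l "y \<circ> r \<circ> r'"] r'(2) xy by auto
    then show "q \<in> N"
      using r r' by (auto simp: N_def)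
  qed
  moreover have "f a \<notin> N"
    using unique by (auto simp: N_def)
  ultimately have "N = {}"
    using clopen[of N] by blast
  then have "inj f"
    unfolding N_def inj_def by blast
  with surj show ?thesis
    by (simp add: bij_def)
qed

lemma nondegenerate_proper_imp_bij:
  assumes "nondegenerate A" and "proper_fun (cubic_map A)"
  shows "bij (cubic_map A)"
\<comment> \<open>The value taken only once is 0, by \<open>cubic_map_eq_0_iff\<close>.\<close>
proof (rule proper_locally_injective_imp_bij[where a = 0])
  show "x = 0" if "cubic_map A x = cubic_map A 0" for x
    using that cubic_map_eq_0_iff[OF assms(1)] by metis
qed (use assms nondegenerate_no_collision continuous_on_cubic_map in blast)+

section \<open>Images of matrices and limit directions when properness fails\<close>

lemma tendsto_vec_power:
  fixes f :: "'a \<Rightarrow> real^'n"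
  assumes "(f \<longlongrightarrow> l) F"
  shows "((\<lambda>x. f x ^ k) \<longlongrightarrow> l ^ k) F"
  by (rule vec_tendstoI) (simp add: vec_power_nth tendsto_power tendsto_vec_nth assms)

lemma subspace_mat_im: "subspace (mat_im A)"
  for A :: "real^'n^'m"
  unfolding mat_im_def
  by (rule linear_subspace_image[OF matrix_vector_mul_linear subspace_UNIV])

lemma mat_im_uminus: "mat_im (- A) = mat_im A"
  for A :: "real^'n^'m"
proof -
  have "(- A) *v x = A *v (- x)" for x
    by (simp add: matrix_vector_mult_def vec_eq_iff)
  then have "mat_im (- A) = (*v) A ` range uminus"
    unfolding mat_im_def image_image by presburger
  then show ?thesis
    by (simp add: mat_im_def)
qed

lemma mat_im_mult: "mat_im (A ** B) = (*v) A ` mat_im B"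
  for A :: "real^'n^'m" and B :: "real^'k^'n"
  by (simp add: mat_im_def image_image matrix_vector_mul_assoc)

text \<open>Writing x = y + z with y in Im(A^T) and z orthogonal to it gives |A z|^2 = <A^T A z, z>
  = 0, hence A x = A y. Hypotheses on Im(AA^T) thereby become hypotheses on Im A, where all vectors
  A x lie.\<close>

lemma mat_im_mult_transpose: "mat_im (A ** transpose A) = mat_im A"
  for A :: "real^'n^'m"
proof
  show "mat_im (A ** transpose A) \<subseteq> mat_im A"
    unfolding mat_im_mult by (auto simp: mat_im_def)
  show "mat_im A \<subseteq> mat_im (A ** transpose A)"
  proof
    fix v assume "v \<in> mat_im A"
    then obtain x where v: "v = A *v x"
      by (auto simp: mat_im_def)
    obtain y z where y: "y \<in> span (mat_im (transpose A))"
      and z: "\<And>w. w \<in> span (mat_im (transpose A)) \<Longrightarrow> orthogonal z w" and x: "x = y + z"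
      using orthogonal_subspace_decomp_exists by blast
    have "(A *v z) \<bullet> (A *v z) = (transpose A *v (A *v z)) \<bullet> z"
      by (simp add: dot_lmul_matrix)
    also have "\<dots> = 0"
      using z[OF span_base, of "transpose A *v (A *v z)"]
      by (simp add: mat_im_def orthogonal_def inner_commute)
    finally have "v = A *v y"
      by (simp add: v x matrix_vector_right_distrib)
    moreover have "y \<in> mat_im (transpose A)"
      using y subspace_mat_im by (metis span_eq_iff)
    ultimately show "v \<in> mat_im (A ** transpose A)"
      by (simp add: mat_im_mult)
  qed
qed

text \<open>Preimages of closed sets are closed by continuity, so only their boundedness is at
  stake.\<close>

lemma proper_cubic_mapI:
  assumes "\<And>C. \<exists>B. \<forall>x. norm (cubic_map A x) \<le> C \<longrightarrow> norm x \<le> B"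
  shows "proper_fun (cubic_map A)"
  unfolding proper_fun_def
proof (intro allI impI)
  fix K :: "(real^'a) set" assume K: "compact K"
  then obtain C where C: "\<And>y. y \<in> K \<Longrightarrow> norm y \<le> C"
    using compact_imp_bounded[OF K] unfolding bounded_iff by blast
  obtain B where "\<And>x. norm (cubic_map A x) \<le> C \<Longrightarrow> norm x \<le> B"
    using assms by blast
  then have "norm x \<le> B" if "x \<in> cubic_map A -` K" for x
    using that C by blast
  then have "bounded (cubic_map A -` K)"
    unfolding bounded_iff by blast
  moreover have "closed (cubic_map A -` K)"
    by (rule closed_vimage[OF compact_imp_closed[OF K] continuous_on_cubic_map])
  ultimately show "compact (cubic_map A -` K)"
    by (simp add: compact_eq_bounded_closed)
qed

text \<open>Crude, but enough to turn unboundedness of x_n into unboundedness of A x_n.\<close>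

lemma norm_vec_cube_le: "norm (x ^ 3) \<le> CARD('n) * norm x ^ 3"
  for x :: "real^'n"
proof -
  have "norm (x ^ 3) \<le> (\<Sum>i\<in>UNIV. \<bar>x $ i\<bar> ^ 3)"
    using norm_le_l1_cart[of "x ^ 3"] by (simp add: vec_power_nth power_abs)
  also have "\<dots> \<le> (\<Sum>i\<in>(UNIV :: 'n set). norm x ^ 3)"
    by (intro sum_mono power_mono component_le_norm_cart) auto
  finally show ?thesis
    by simp
qed

lemma mult_cube_eq: "A *v ((A *v x) ^ 3) = A *v cubic_map A x - A *v x"
  by (simp add: cubic_map_def matrix_vector_right_distrib)

text \<open>The sequences are returned along with the limit direction \<open>w\<close>, because
  conditions (5) and (6) use how they converge and not only the equation for
  \<open>w\<close>.\<close>

lemma not_proper_cubic_mapE: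
  assumes "\<not> proper_fun (cubic_map A)"
  obtains x :: "nat \<Rightarrow> real^'n" and w where
    "(\<lambda>n. cubic_map A (x n) /\<^sub>R norm (A *v x n)) \<longlonglongrightarrow> 0"
    "(\<lambda>n. sgn (A *v x n)) \<longlonglongrightarrow> w" "w \<noteq> 0" "w \<in> mat_im A" "A *v (w ^ 3) = 0"
proof -
  obtain C where "\<not> (\<exists>B. \<forall>x. norm (cubic_map A x) \<le> C \<longrightarrow> norm x \<le> B)"
    using assms proper_cubic_mapI by blast
  then have "\<forall>n::nat. \<exists>x. norm (cubic_map A x) \<le> C \<and> n < norm x"
    by (meson not_le)
  then obtain x where C: "\<And>n::nat. norm (cubic_map A (x n)) \<le> C" and large: "\<And>n. n < norm (x n)"
    by metis
  \<comment> \<open>Since x = F(x) - (A x)^3 and the values F(x) are bounded along the sequence,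
    \<open>x n\<close> can be large only if \<open>A *v x n\<close> is large.\<close>
  have bound: "n < C + CARD('n) * norm (A *v x n) ^ 3" for n
  proof -
    have "x n = cubic_map A (x n) - (A *v x n) ^ 3"
      by (simp add: cubic_map_def)
    then have "norm (x n) \<le> norm (cubic_map A (x n)) + norm ((A *v x n) ^ 3)"
      by (metis norm_triangle_ineq4)
    then show ?thesis
      using C[of n] large[of n] norm_vec_cube_le[of "A *v x n"] by linarith
  qed
  have at_top: "filterlim (\<lambda>n. norm (A *v x n)) at_top sequentially"
    unfolding filterlim_at_top_gt[where c = 0]
  proof (intro allI impI)
    fix Z :: real assume "Z > 0"
    have "Z \<le> norm (A *v x n)" if "n \<ge> nat \<lceil>C + CARD('n) * Z ^ 3\<rceil>" for n
    proof (rule ccontr)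
      assume "\<not> ?thesis"
      then have "norm (A *v x n) ^ 3 \<le> Z ^ 3"
        by (intro power_mono) auto
      then have "CARD('n) * norm (A *v x n) ^ 3 \<le> CARD('n) * Z ^ 3"
        by (intro mult_left_mono) auto
      then show False
        using bound[of n] that by linarith
    qed
    then show "\<forall>\<^sub>F n in sequentially. Z \<le> norm (A *v x n)"
      unfolding eventually_sequentially by blast
  qed
  have "seq_compact (cball (0::real^'n) 1)" "\<forall>n. sgn (A *v x n) \<in> cball 0 1"
    by (simp_all add: compact_imp_seq_compact norm_sgn)
  then obtain w r where r: "strict_mono r" and w: "(\<lambda>n. sgn (A *v x (r n))) \<longlonglongrightarrow> w"
    using seq_compactE[of "cball 0 1" "\<lambda>n. sgn (A *v x n)"] unfolding o_def by blast
  have at_top_r: "filterlim (\<lambda>n. norm (A *v x (r n))) at_top sequentially"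
    by (rule filterlim_compose[OF at_top filterlim_subseq[OF r]])
  define c where "c n = inverse (norm (A *v x (r n)))" for n
  have c: "c \<longlonglongrightarrow> 0"
    unfolding c_def by (rule tendsto_inverse_0_at_top[OF at_top_r])
  have lim0: "(\<lambda>n. cubic_map A (x (r n)) /\<^sub>R norm (A *v x (r n))) \<longlonglongrightarrow> 0"
  proof (rule Lim_null_comparison)
    show "\<forall>\<^sub>F n in sequentially. norm (cubic_map A (x (r n)) /\<^sub>R norm (A *v x (r n))) \<le> C * c n"
    proof (intro always_eventually allI)
      fix n
      have "norm (cubic_map A (x (r n)) /\<^sub>R norm (A *v x (r n))) = norm (cubic_map A (x (r n))) * c n"
        by (simp add: c_def)
      also have "\<dots> \<le> C * c n"
        by (rule mult_right_mono[OF C]) (simp add: c_def)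
      finally show "norm (cubic_map A (x (r n)) /\<^sub>R norm (A *v x (r n))) \<le> C * c n" .
    qed
    show "(\<lambda>n. C * c n) \<longlonglongrightarrow> 0"
      using tendsto_mult_right_zero[OF c] .
  qed
  have "\<forall>\<^sub>F n in sequentially. 0 < norm (A *v x (r n))"
    using at_top_r unfolding filterlim_at_top_dense by (rule spec)
  then have "\<forall>\<^sub>F n in sequentially. norm (sgn (A *v x (r n))) = 1"
    by (rule eventually_mono) (simp add: norm_sgn)
  then have "(\<lambda>n. norm (sgn (A *v x (r n)))) \<longlonglongrightarrow> 1"
    by (rule tendsto_eventually)
  then have "norm w = 1"
    by (rule LIMSEQ_unique[OF tendsto_norm[OF w]])
  then have "w \<noteq> 0"
    by auto
  moreover have "w \<in> mat_im A"
  proof (rule closed_sequentially[OF closed_subspace[OF subspace_mat_im] _ w])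
    show "sgn (A *v x (r n)) \<in> mat_im A" for n
      unfolding sgn_div_norm by (intro subspace_scale subspace_mat_im) (simp add: mat_im_def)
  qed
  moreover have "A *v (w ^ 3) = 0"
  proof (rule LIMSEQ_unique)
    show "(\<lambda>n. A *v (sgn (A *v x (r n)) ^ 3)) \<longlonglongrightarrow> A *v (w ^ 3)"
      by (intro bounded_linear.tendsto[OF matrix_vector_mul_bounded_linear] tendsto_vec_power w)
    \<comment> \<open>Dividing A(u^3) = A F(x) - u by |u|^3 leaves the factor |u|^(-2) in front of
      convergent sequences, which forces the limit 0.\<close>
    have "A *v (sgn (A *v x (r n)) ^ 3) =
        (c n)\<^sup>2 *\<^sub>R (A *v (cubic_map A (x (r n)) /\<^sub>R norm (A *v x (r n)))) - (c n)\<^sup>2 *\<^sub>R sgn (A *v x (r n))" for n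
    proof -
      have "sgn (A *v x (r n)) ^ 3 = (c n) ^ 3 *\<^sub>R (A *v x (r n)) ^ 3"
        by (simp add: vec_eq_iff vec_power_nth sgn_div_norm c_def power_mult_distrib)
      then have "A *v (sgn (A *v x (r n)) ^ 3) = (c n) ^ 3 *\<^sub>R (A *v cubic_map A (x (r n)) - A *v x (r n))"
        by (simp add: matrix_vector_mult_scaleR mult_cube_eq)
      then show ?thesis
        by (simp add: sgn_div_norm flip: c_def)
          (simp add: matrix_vector_mult_scaleR scaleR_diff_right power2_eq_square power3_eq_cube mult.assoc)
    qed
    moreover have "(\<lambda>n. (c n)\<^sup>2 *\<^sub>R (A *v (cubic_map A (x (r n)) /\<^sub>R norm (A *v x (r n))))
          - (c n)\<^sup>2 *\<^sub>R sgn (A *v x (r n))) \<longlonglongrightarrow> 0\<^sup>2 *\<^sub>R (A *v 0) - 0\<^sup>2 *\<^sub>R w"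
      by (intro tendsto_intros c w lim0 bounded_linear.tendsto[OF matrix_vector_mul_bounded_linear])
    ultimately show "(\<lambda>n. A *v (sgn (A *v x (r n)) ^ 3)) \<longlonglongrightarrow> 0"
      by simp
  qed
  ultimately show thesis
    by (rule that[OF lim0 w])
qed

section \<open>Condition (1): the kernel inclusion\<close>

text \<open>By the inclusion, A(w^3) = 0 gives AA^T(w^3) = 0 and hence A^T(w^3) = 0. So w^3 is
  orthogonal to Im A, which contains w, and the sum of the w_i^4 is 0.\<close>

lemma proper_if_ker_subset:
  assumes "mat_ker A \<subseteq> mat_ker (A ** transpose A)"
  shows "proper_fun (cubic_map A)"
proof (rule ccontr)
  assume "\<not> ?thesis"
  then obtain w where w: "w \<noteq> 0" "w \<in> mat_im A" "A *v (w ^ 3) = 0"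
    by (rule not_proper_cubic_mapE)
  then have "A *v (transpose A *v (w ^ 3)) = 0"
    using assms unfolding mat_ker_def matrix_vector_mul_assoc by blast
  then have "(transpose A *v (w ^ 3)) \<bullet> (transpose A *v (w ^ 3)) = 0"
    by (simp add: dot_lmul_matrix)
  then have T0: "transpose A *v (w ^ 3) = 0"
    by simp
  obtain z where z: "w = A *v z"
    using w(2) by (auto simp: mat_im_def)
  have "w ^ 3 \<bullet> w = (transpose A *v (w ^ 3)) \<bullet> z"
    by (simp add: dot_lmul_matrix z)
  also have "\<dots> = 0"
    by (simp only: T0 inner_zero_left)
  finally have "(\<Sum>i\<in>UNIV. (w $ i) ^ 4) = 0"
    by (simp add: inner_vec_def vec_power_nth eval_nat_numeral ac_simps)
  then have "\<forall>i. (w $ i) ^ 4 = 0"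
    by (subst (asm) sum_nonneg_eq_0_iff) auto
  then show False
    using w(1) by (simp add: vec_eq_iff)
qed

text \<open>In each case A x = 0 implies A^T x = 0: either x = 0, or A^T x is A x or - A x.\<close>

lemma ker_subset_ker_mult_transpose:
  fixes A :: "real^'n^'n"
  assumes "invertible A \<or> transpose A = A \<or> transpose A = - A"
  shows "mat_ker A \<subseteq> mat_ker (A ** transpose A)"
proof
  fix x assume x: "x \<in> mat_ker A"
  have "transpose A *v x = 0"
    using assms
  proof (elim disjE)
    assume "invertible A"
    then have "\<exists>B. B ** A = mat 1"
      by (auto simp: invertible_def)
    then have "x = 0"
      using x unfolding matrix_left_invertible_ker mat_ker_def by blast
    then show ?thesis
      by simp
  next
    assume "transpose A = - A"
    then show ?thesis
      using x by (simp add: mat_ker_def matrix_vector_mult_def vec_eq_iff sum_negf)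
  qed (use x in \<open>simp add: mat_ker_def\<close>)
  then show "x \<in> mat_ker (A ** transpose A)"
    by (simp add: mat_ker_def flip: matrix_vector_mul_assoc)
qed

section \<open>Conditions (5) and (2): the weighted inequality and rank one\<close>

text \<open>With u = A x, pairing A(u^3) = A F(x) - u with \<zeta> * u gives <u, \<zeta> * u> \<le>
  <A F(x), \<zeta> * u>. Divided by |u|^2 along the sequence, the right-hand side tends to 0, so the
  positive definite form <w, \<zeta> * w> is at most 0.\<close>

lemma proper_if_weighted_cubic_nonneg:
  assumes "weighted_cubic_nonneg A \<zeta>"
  shows "proper_fun (cubic_map A)"
proof (rule ccontr)
  assume "\<not> ?thesis"
  then obtain x w where lim0: "(\<lambda>n. cubic_map A (x n) /\<^sub>R norm (A *v x n)) \<longlonglongrightarrow> 0"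
    and w: "(\<lambda>n. sgn (A *v x n)) \<longlonglongrightarrow> w" "w \<noteq> 0"
    by (rule not_proper_cubic_mapE)
  have pos: "\<zeta> $ i > 0" for i
    using assms by (simp add: weighted_cubic_nonneg_def)
  have \<zeta>: "(\<lambda>n. \<zeta> * sgn (A *v x n)) \<longlonglongrightarrow> \<zeta> * w"
    by (rule vec_tendstoI) (simp add: tendsto_mult_left tendsto_vec_nth w(1))
  have "sgn (A *v x n) \<bullet> (\<zeta> * sgn (A *v x n))
      \<le> (A *v (cubic_map A (x n) /\<^sub>R norm (A *v x n))) \<bullet> (\<zeta> * sgn (A *v x n))" for n
  proof -
    define u c where "u = A *v x n" and "c = inverse (norm u)"
    have "u \<in> mat_im (A ** transpose A)"
      unfolding mat_im_mult_transpose by (simp add: u_def mat_im_def)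
    then have "0 \<le> (A *v (u ^ 3)) \<bullet> (\<zeta> * u)"
      using assms by (simp add: weighted_cubic_nonneg_def)
    then have "u \<bullet> (\<zeta> * u) \<le> (A *v cubic_map A (x n)) \<bullet> (\<zeta> * u)"
      by (simp add: u_def mult_cube_eq inner_diff_left)
    then have "c\<^sup>2 * (u \<bullet> (\<zeta> * u)) \<le> c\<^sup>2 * ((A *v cubic_map A (x n)) \<bullet> (\<zeta> * u))"
      by (simp add: mult_left_mono)
    moreover have "\<zeta> * (c *\<^sub>R u) = c *\<^sub>R (\<zeta> * u)"
      by (simp add: vec_eq_iff)
    ultimately show ?thesis
      unfolding sgn_div_norm u_def[symmetric] c_def[symmetric]
      by (simp add: matrix_vector_mult_scaleR power2_eq_square mult.assoc)
  qed
  moreover have "(\<lambda>n. sgn (A *v x n) \<bullet> (\<zeta> * sgn (A *v x n))) \<longlonglongrightarrow> w \<bullet> (\<zeta> * w)"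
    by (intro tendsto_inner w \<zeta>)
  moreover have "(\<lambda>n. (A *v (cubic_map A (x n) /\<^sub>R norm (A *v x n))) \<bullet> (\<zeta> * sgn (A *v x n)))
      \<longlonglongrightarrow> (A *v 0) \<bullet> (\<zeta> * w)"
    by (intro tendsto_inner \<zeta> bounded_linear.tendsto[OF matrix_vector_mul_bounded_linear] lim0)
  ultimately have "w \<bullet> (\<zeta> * w) \<le> (A *v 0) \<bullet> (\<zeta> * w)"
    by (intro LIMSEQ_le) auto
  then have "(\<Sum>i\<in>UNIV. \<zeta> $ i * (w $ i)\<^sup>2) \<le> 0"
    by (simp add: inner_vec_def power2_eq_square ac_simps)
  moreover have nonneg: "0 \<le> \<zeta> $ i * (w $ i)\<^sup>2" for i
    using pos[of i] by simp
  ultimately have "(\<Sum>i\<in>UNIV. \<zeta> $ i * (w $ i)\<^sup>2) = 0"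
    by (intro antisym sum_nonneg) auto
  then have "\<forall>i. \<zeta> $ i * (w $ i)\<^sup>2 = 0"
    using nonneg by (subst (asm) sum_nonneg_eq_0_iff) auto
  then have "w = 0"
    using pos by (simp add: vec_eq_iff less_imp_neq[symmetric])
  with w(2) show False ..
qed

text \<open>The limit direction for -A is a nonzero w in Im A with A(w^3) = 0, at which the pairing
  would vanish.\<close>

lemma proper_uminus_if_weighted_cubic_nonzero:
  assumes "\<And>x. \<lbrakk>x \<in> mat_im (A ** transpose A); x \<noteq> 0\<rbrakk> \<Longrightarrow> (A *v (x ^ 3)) \<bullet> (\<zeta> * x) \<noteq> 0"
  shows "proper_fun (cubic_map (- A))"
proof (rule ccontr)
  assume "\<not> ?thesis"
  then obtain w where "w \<noteq> 0" "w \<in> mat_im (- A)" "(- A) *v (w ^ 3) = 0"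
    by (rule not_proper_cubic_mapE)
  moreover from this(3) have "A *v (w ^ 3) = 0"
    by (simp add: matrix_vector_mult_def vec_eq_iff sum_negf)
  ultimately show False
    using assms[of w] by (simp add: mat_im_mult_transpose mat_im_uminus)
qed

text \<open>The image lies on the line through a vector a, and A(a^3) = k a, so the form at s a is
  s^4 k |a|^2 and the sign of k decides. A negative k would produce a singular Jacobian with a^3 in
  its kernel.\<close>

lemma weighted_cubic_nonneg_if_rank_1:
  assumes A: "nondegenerate A" and rank: "rank (A ** transpose A) = 1"
  shows "weighted_cubic_nonneg A 1"
proof -
  have "dim (mat_im A) = 1"
    using rank by (metis mat_im_def mat_im_mult_transpose rank_dim_range)
  then obtain B where "B \<subseteq> mat_im A" "mat_im A \<subseteq> span B" "card B = 1"
    by (metis basis_exists)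
  then obtain a where a: "a \<in> mat_im A" and im: "mat_im A \<subseteq> span {a}"
    by (metis card_1_singletonE insert_subset)
  obtain k where k: "A *v (a ^ 3) = k *\<^sub>R a"
    using im unfolding span_singleton by (metis (no_types, lifting) imageE mat_im_def rangeI subsetD)
  have "0 \<le> k \<or> a = 0"
  proof (rule ccontr)
    assume "\<not> (0 \<le> k \<or> a = 0)"
    then have "k < 0" "a \<noteq> 0"
      by auto
    \<comment> \<open>Chosen so that 1 + 3 t^2 k = 0; at a point z with A z = t a this is the factor
      by which the Jacobian scales the coordinates of a^3.\<close>
    define t where "t = sqrt (- 1 / (3 * k))"
    have t: "3 * t\<^sup>2 * k = - 1"
      using \<open>k < 0\<close> by (simp add: t_def divide_nonneg_neg field_simps)
    obtain z where z: "A *v z = t *\<^sub>R a"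
      using subspace_scale[OF subspace_mat_im a, of t] by (auto simp: mat_im_def)
    have "(a ^ 3) $ i + 3 * ((A *v z) $ i)\<^sup>2 * (A *v (a ^ 3)) $ i = 0" for i
    proof -
      have "(a ^ 3) $ i + 3 * ((A *v z) $ i)\<^sup>2 * (A *v (a ^ 3)) $ i = (a $ i) ^ 3 * (1 + 3 * t\<^sup>2 * k)"
        unfolding z k by (simp add: vec_power_nth power_mult_distrib power2_eq_square power3_eq_cube algebra_simps)
      then show ?thesis
        by (simp add: t)
    qed
    then have "a ^ 3 = 0"
      using A unfolding nondegenerate_def by blast
    then show False
      using \<open>a \<noteq> 0\<close> by (simp add: vec_eq_iff vec_power_nth)
  qed
  moreover have "(A *v (x ^ 3)) \<bullet> (1 * x) = s ^ 4 * (k * (a \<bullet> a))" if "x = s *\<^sub>R a" for x s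
  proof -
    have "x ^ 3 = s ^ 3 *\<^sub>R a ^ 3"
      by (simp add: that vec_eq_iff vec_power_nth power_mult_distrib)
    moreover have "s ^ 4 = s ^ 3 * s"
      by (simp add: eval_nat_numeral)
    ultimately show ?thesis
      by (simp add: that matrix_vector_mult_scaleR k ac_simps)
  qed
  moreover have "\<exists>s. x = s *\<^sub>R a" if "x \<in> mat_im (A ** transpose A)" for x
    using that im unfolding mat_im_mult_transpose span_singleton by blast
  ultimately show ?thesis
    unfolding weighted_cubic_nonneg_def by (fastforce simp: zero_le_mult_iff)
qed

section \<open>Condition (4): conjugation by a diagonal matrix\<close>

text \<open>With B = D A D^(-3) one has B D^3 x = D A x, and cubing the coordinates turns the
  diagonal entries d_i of D into the entries d_i^3 of D^3.\<close>

lemma cubic_map_conjugate_diagonal: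
  assumes D: "diagonal_matrix D" "invertible D"
  shows "cubic_map (D ** A ** matrix_inv (D ** D ** D)) ((D ** D ** D) *v x) = (D ** D ** D) *v cubic_map A x"
proof -
  have D_nth: "(D *v y) $ i = D $ i $ i * y $ i" for y i
  proof -
    have "(D *v y) $ i = (\<Sum>j\<in>UNIV. if j = i then D $ i $ i * y $ i else 0)"
      unfolding matrix_vector_mult_def vec_lambda_beta
      by (rule sum.cong) (use D(1) in \<open>auto simp: diagonal_matrix_def\<close>)
    then show ?thesis
      by simp
  qed
  have "invertible (D ** D ** D)"
    using D(2) by (intro invertible_mult)
  then have "matrix_inv (D ** D ** D) ** (D ** D ** D) = mat 1"
    unfolding invertible_def matrix_inv_def by (rule someI_ex[THEN conjunct2])
  then have B: "(D ** A ** matrix_inv (D ** D ** D)) *v ((D ** D ** D) *v x) = D *v (A *v x)"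
    by (metis matrix_mul_assoc matrix_mul_rid matrix_vector_mul_assoc)
  have "((D ** D ** D) *v y) $ i = (D $ i $ i) ^ 3 * y $ i" for y i
    by (simp add: D_nth power3_eq_cube flip: matrix_vector_mul_assoc)
  then show ?thesis
    by (simp add: vec_eq_iff cubic_map_nth B D_nth power_mult_distrib distrib_left)
qed

text \<open>Since F_A = E^(-1) F_B E with E = D^3, preimages under F_A are linear images of
  preimages under F_B.\<close>

lemma proper_if_diagonal_conjugate_proper:
  assumes D: "diagonal_matrix D" "invertible D"
    and proper: "proper_fun (cubic_map (D ** A ** matrix_inv (D ** D ** D)))"
  shows "proper_fun (cubic_map A)"
  unfolding proper_fun_def
proof (intro allI impI)
  fix K :: "(real^'a) set" assume K: "compact K"
  define E where "E = D ** D ** D"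
  define F where "F = cubic_map (D ** A ** matrix_inv E)"
  have "invertible E"
    unfolding E_def using D(2) by (intro invertible_mult)
  then obtain E' where E': "E' ** E = mat 1" "E ** E' = mat 1"
    by (auto simp: invertible_def)
  have inv: "E' *v (E *v y) = y" "E *v (E' *v y) = y" for y
    by (simp_all add: matrix_vector_mul_assoc E')
  have FE: "F (E *v x) = E *v cubic_map A x" for x
    unfolding F_def E_def by (rule cubic_map_conjugate_diagonal[OF D])
  have "cubic_map A -` K = (*v) E' ` (F -` (*v) E ` K)"
  proof (intro set_eqI iffI)
    fix x assume "x \<in> cubic_map A -` K"
    then have "E *v x \<in> F -` (*v) E ` K"
      by (auto simp: FE)
    then show "x \<in> (*v) E' ` (F -` (*v) E ` K)"
      by (metis inv(1) imageI)
  next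
    fix x assume "x \<in> (*v) E' ` (F -` (*v) E ` K)"
    then obtain y k where "x = E' *v y" "F y = E *v k" "k \<in> K"
      by auto
    then have "E *v cubic_map A x = E *v k"
      by (metis FE inv(2))
    then show "x \<in> cubic_map A -` K"
      using \<open>k \<in> K\<close> by (metis inv(1) vimageI)
  qed
  moreover have "compact ((*v) E ` K)"
    by (intro compact_continuous_image K linear_continuous_on matrix_vector_mul_bounded_linear)
  then have "compact (F -` (*v) E ` K)"
    using proper unfolding proper_fun_def F_def E_def by blast
  then have "compact ((*v) E' ` (F -` (*v) E ` K))"
    by (intro compact_continuous_image linear_continuous_on matrix_vector_mul_bounded_linear)
  ultimately show "compact (cubic_map A -` K)"
    by simp
qed

section \<open>Condition (3): triangular matrices\<close>

text \<open>As \<open>a\<close> is nonnegative, a x has the sign of \<open>x\<close>, so the cube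
  can work against \<open>x\<close> only through \<open>r\<close>, by at most S^3.\<close>

lemma abs_le_if_abs_add_cube_le:
  fixes x a r S C :: real
  assumes a: "a \<ge> 0" and r: "\<bar>r\<bar> \<le> S" and C: "\<bar>x + (a * x + r) ^ 3\<bar> \<le> C"
  shows "\<bar>x\<bar> \<le> C + S ^ 3"
proof (cases "x \<ge> 0")
  case True
  then have "- S \<le> a * x + r"
    using mult_nonneg_nonneg[OF a] r by fastforce
  then have "(- S) ^ 3 \<le> (a * x + r) ^ 3"
    by (rule power_mono_odd[rotated]) simp
  then show ?thesis
    using True C by simp
next
  case False
  then have "a * x + r \<le> S"
    using mult_nonneg_nonpos[OF a, of x] r by linarith
  then have "(a * x + r) ^ 3 \<le> S ^ 3"
    by (rule power_mono_odd[rotated]) simp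
  then show ?thesis
    using False C by simp
qed

text \<open>Triangular matrices are treated uniformly through a rank function on the indices:
  \<open>\<rho> i\<close> counts the indices below \<open>i\<close> in the lower case and above \<open>i\<close> in the upper case.\<close>

lemma proper_if_ranked:
  fixes A :: "real^'n^'n" and \<rho> :: "'n \<Rightarrow> nat"
  assumes diag: "\<And>i. A $ i $ i \<ge> 0"
    and ranked: "\<And>i j. \<lbrakk>A $ i $ j \<noteq> 0; j \<noteq> i\<rbrakk> \<Longrightarrow> \<rho> j < \<rho> i"
  shows "proper_fun (cubic_map A)"
proof (rule proper_cubic_mapI)
  fix C
  have "\<exists>B. \<forall>x. norm (cubic_map A x) \<le> C \<longrightarrow> \<bar>x $ i\<bar> \<le> B" for i
  proof (induction i rule: measure_induct_rule[of \<rho>])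
    case (less i)
    then have "\<exists>b. \<forall>j. \<rho> j < \<rho> i \<longrightarrow> (\<forall>x. norm (cubic_map A x) \<le> C \<longrightarrow> \<bar>x $ j\<bar> \<le> b j)"
      by metis
    then obtain b where b: "\<And>j x. \<lbrakk>\<rho> j < \<rho> i; norm (cubic_map A x) \<le> C\<rbrakk> \<Longrightarrow> \<bar>x $ j\<bar> \<le> b j"
      by blast
    have "\<bar>x $ i\<bar> \<le> C + (\<Sum>j\<in>UNIV - {i}. \<bar>A $ i $ j\<bar> * b j) ^ 3" if x: "norm (cubic_map A x) \<le> C" for x
    proof (rule abs_le_if_abs_add_cube_le[OF diag[of i]])
      \<comment> \<open>\<open>b j\<close> is a bound only for j of lower rank; for the other j the
        entry \<open>A $ i $ j\<close> is 0 and both sides vanish.\<close>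
      have "\<bar>A $ i $ j * x $ j\<bar> \<le> \<bar>A $ i $ j\<bar> * b j" if "j \<in> UNIV - {i}" for j
        using b[OF ranked x, of j] that by (cases "A $ i $ j = 0") (auto simp: abs_mult mult_left_mono)
      then show "\<bar>\<Sum>j\<in>UNIV - {i}. A $ i $ j * x $ j\<bar> \<le> (\<Sum>j\<in>UNIV - {i}. \<bar>A $ i $ j\<bar> * b j)"
        by (intro order_trans[OF sum_abs] sum_mono)
      have "(A *v x) $ i = A $ i $ i * x $ i + (\<Sum>j\<in>UNIV - {i}. A $ i $ j * x $ j)"
        by (simp add: matrix_vector_mult_def sum.remove[of UNIV i])
      then show "\<bar>x $ i + (A $ i $ i * x $ i + (\<Sum>j\<in>UNIV - {i}. A $ i $ j * x $ j)) ^ 3\<bar> \<le> C"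
        using component_le_norm_cart[of "cubic_map A x" i] x by (simp add: cubic_map_nth)
    qed
    then show ?case
      by blast
  qed
  then obtain B where B: "\<And>i x. norm (cubic_map A x) \<le> C \<Longrightarrow> \<bar>x $ i\<bar> \<le> B i"
    by metis
  have "norm x \<le> (\<Sum>i\<in>UNIV. B i)" if "norm (cubic_map A x) \<le> C" for x
    by (rule order_trans[OF norm_le_l1_cart]) (intro sum_mono B that)
  then show "\<exists>B. \<forall>x. norm (cubic_map A x) \<le> C \<longrightarrow> norm x \<le> B"
    by blast
qed

text \<open>The Jacobian is triangular too, so its determinant is the product of the factors 1 + 3
  (A x)_i^2 A_ii. On the axis x = t e_i such a factor is 1 + 3 t^2 A_ii^3, which vanishes for some t
  if A_ii < 0.\<close>

lemma diagonal_nonneg_if_triangular: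
  fixes A :: "real^('n::{finite,wellorder})^('n::{finite,wellorder})"
  assumes det: "\<forall>x. det (jacobian (cubic_map A) (at x)) \<noteq> 0"
    and tri: "upper_triangular_matrix A \<or> lower_triangular_matrix A"
  shows "A $ i $ i \<ge> 0"
proof (rule ccontr)
  assume neg: "\<not> ?thesis"
  define J where "J x = jacobian (cubic_map A) (at x)" for x
  have J: "J x $ i $ j = (if i = j then 1 else 0) + 3 * ((A *v x) $ i)\<^sup>2 * A $ i $ j" for x i j
    by (simp add: J_def jacobian_cubic_map)
  have det_J: "det (J x) = (\<Prod>i\<in>UNIV. J x $ i $ i)" for x
    using tri
  proof
    assume "upper_triangular_matrix A"
    then show ?thesis
      by (intro det_upperdiagonal) (auto simp: J upper_triangular_matrix_def)
  next
    assume "lower_triangular_matrix A"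
    then show ?thesis
      by (intro det_lowerdiagonal) (auto simp: J lower_triangular_matrix_def)
  qed
  define t where "t = sqrt (- 1 / (3 * (A $ i $ i) ^ 3))"
  have "(A $ i $ i) ^ 3 < 0"
    using neg by (simp add: not_le)
  then have t: "3 * t\<^sup>2 * (A $ i $ i) ^ 3 = - 1"
    by (simp add: t_def divide_nonneg_neg field_simps)
  have "(A *v (t *\<^sub>R axis i 1)) $ i = t * A $ i $ i"
    by (simp add: matrix_vector_mult_scaleR matrix_vector_mult_basis column_def)
  then have "J (t *\<^sub>R axis i 1) $ i $ i = 0"
    using t by (simp add: J power_mult_distrib power2_eq_square power3_eq_cube ac_simps)
  then have "det (J (t *\<^sub>R axis i 1)) = 0"
    unfolding det_J by (intro prod_zero) auto
  then show False
    using det by (simp add: J_def)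
qed

lemma proper_if_triangular:
  fixes A :: "real^('n::{finite,wellorder})^('n::{finite,wellorder})"
  assumes det: "\<forall>x. det (jacobian (cubic_map A) (at x)) \<noteq> 0"
    and tri: "upper_triangular_matrix A \<or> lower_triangular_matrix A"
  shows "proper_fun (cubic_map A)"
  using tri
proof
  assume upper: "upper_triangular_matrix A"
  show ?thesis
  proof (rule proper_if_ranked[where \<rho> = "\<lambda>i. card {i<..}", OF diagonal_nonneg_if_triangular[OF det tri]])
    fix i j assume "A $ i $ j \<noteq> 0" "j \<noteq> i"
    then have "i < j"
      using upper unfolding upper_triangular_matrix_def by (metis not_less_iff_gr_or_eq)
    then show "card {j<..} < card {i<..}"
      by (intro psubset_card_mono) auto
  qed
next
  assume lower: "lower_triangular_matrix A"
  show ?thesis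
  proof (rule proper_if_ranked[where \<rho> = "\<lambda>i. card {..<i}", OF diagonal_nonneg_if_triangular[OF det tri]])
    fix i j assume "A $ i $ j \<noteq> 0" "j \<noteq> i"
    then have "j < i"
      using lower unfolding lower_triangular_matrix_def by (metis not_less_iff_gr_or_eq)
    then show "card {..<j} < card {..<i}"
      by (intro psubset_card_mono) auto
  qed
qed

section \<open>Condition (6): kernel spanned by the all-ones vector\<close>

text \<open>Here \<open>w = k \<cdot> 1\<close>, so the first-order argument is not enough. Subtracting from \<open>u\<^sub>n\<^sup>3\<close> a multiple
  of \<open>1\<close> and dividing by \<open>|u\<^sub>n|\<close> gives vectors \<open>g\<^sub>n\<close> on which \<open>A\<close> is injective and with
  \<open>A g\<^sub>n\<close> tending to \<open>- w\<close>, so \<open>g\<^sub>n\<close> tends to some \<open>q\<close>. Factoring the differences of cubes in \<open>g\<^sub>n\<close>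
  shows that \<open>q\<close> is, up to the factor \<open>3k\<^sup>2\<close>, a limit of elements \<open>t\<^sub>n\<close> of \<open>Im A\<close>; hence
  \<open>1 = A(- q / k)\<close> lies in \<open>A(Im A)\<close>.\<close>

lemma proper_if_ker_span_1:
  fixes A :: "real^'n^'n"
  assumes ker: "mat_ker A = span {1}"
    and notin: "1 \<notin> mat_im (A ** transpose A) \<inter> mat_im (A ** A ** transpose A)"
  shows "proper_fun (cubic_map A)"
proof (rule ccontr)
  assume "\<not> ?thesis"
  then obtain x w where lim0: "(\<lambda>n. cubic_map A (x n) /\<^sub>R norm (A *v x n)) \<longlonglongrightarrow> 0"
    and s: "(\<lambda>n. sgn (A *v x n)) \<longlonglongrightarrow> w"
    and w: "w \<noteq> 0" "w \<in> mat_im A" "A *v (w ^ 3) = 0"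
    by (rule not_proper_cubic_mapE)
  have "w ^ 3 \<in> mat_ker A"
    using w(3) by (simp add: mat_ker_def)
  then obtain c where c: "w ^ 3 = c *\<^sub>R 1"
    unfolding ker span_singleton by blast
  define k where "k = root 3 c"
  have w_eq: "w = k *\<^sub>R 1"
  proof -
    have "(w $ i) ^ 3 = c" for i
      using c by (simp add: vec_eq_iff vec_power_nth)
    then have "w $ i = k" for i
      using odd_real_root_power_cancel[of 3 "w $ i"] by (simp add: k_def)
    then show ?thesis
      by (simp add: vec_eq_iff)
  qed
  have k: "k \<noteq> 0"
    using w(1) w_eq by auto
  have A1: "A *v 1 = 0"
    using ker span_base[of 1 "{1}"] by (auto simp: mat_ker_def)
  have im1: "1 \<in> mat_im A"
    using subspace_scale[OF subspace_mat_im w(2), of "inverse k"] w_eq k by simp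
  \<comment> \<open>\<open>m\<close> is the coordinate used for normalisation: the hyperplane
    \<open>H\<close> is a complement of Ker A = span {1}, so \<open>A\<close> has a linear left
    inverse \<open>B\<close> on it.\<close>
  obtain m :: 'n where True
    by simp
  define H where "H = {h :: real^'n. h $ m = 0}"
  have "subspace H"
    by (auto simp: H_def subspace_def)
  moreover have "inj_on ((*v) A) H"
  proof (rule inj_onI)
    fix g h assume gh: "g \<in> H" "h \<in> H" "A *v g = A *v h"
    then have "g - h \<in> mat_ker A"
      by (simp add: mat_ker_def matrix_vector_mult_diff_distrib)
    then obtain d where d: "g - h = d *\<^sub>R 1"
      unfolding ker span_singleton by blast
    then have "(g - h) $ m = d"
      by simp
    then have "d = 0"
      using gh by (simp add: H_def)
    with d show "g = h"
      by simp
  qed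
  ultimately obtain B where B: "linear B" "\<And>h. h \<in> H \<Longrightarrow> B (A *v h) = h"
    using linear_exists_left_inverse_on[OF matrix_vector_mul_linear] by blast
  define u where "u n = A *v x n" for n
  \<comment> \<open>Subtracting a multiple of 1 does not change the image under \<open>A\<close> and
    puts \<open>g n\<close> into \<open>H\<close>, so \<open>B\<close> recovers \<open>g n\<close>
    from \<open>A *v g n\<close>.\<close>
  define g where "g n = (u n ^ 3 - (u n $ m) ^ 3 *\<^sub>R 1) /\<^sub>R norm (u n)" for n
  define q where "q = B (- w)"
  have "(\<lambda>n. A *v g n) \<longlonglongrightarrow> A *v 0 - w"
  proof -
    have "A *v g n = A *v (cubic_map A (x n) /\<^sub>R norm (A *v x n)) - sgn (A *v x n)" for n
      unfolding g_def u_def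
      by (simp add: matrix_vector_mult_scaleR matrix_vector_mult_diff_distrib A1 mult_cube_eq
          sgn_div_norm scaleR_diff_right)
    then show ?thesis
      by (simp only:)
        (intro tendsto_diff s lim0 bounded_linear.tendsto[OF matrix_vector_mul_bounded_linear])
  qed
  then have Ag: "(\<lambda>n. A *v g n) \<longlonglongrightarrow> - w"
    by simp
  have "(\<lambda>n. B (A *v g n)) \<longlonglongrightarrow> q"
    unfolding q_def by (rule bounded_linear.tendsto[OF linear_conv_bounded_linear[THEN iffD1, OF B(1)] Ag])
  moreover have "g n \<in> H" for n
    by (simp add: H_def g_def vec_power_nth)
  ultimately have g: "g \<longlonglongrightarrow> q"
    by (simp add: B(2))
  have "(\<lambda>n. A *v g n) \<longlonglongrightarrow> A *v q"
    by (intro bounded_linear.tendsto[OF matrix_vector_mul_bounded_linear] g)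
  then have Aq: "A *v q = - w"
    by (rule LIMSEQ_unique[OF _ Ag])
  \<comment> \<open>\<open>t n\<close> stays in Im A because 1 lies there. Since a^3 - b^3 has the
    factor a - b, coordinate i of \<open>g n\<close> is that of \<open>t n\<close> times
    \<open>Q n i\<close>, which tends to 3 k^2.\<close>
  define t where "t n = norm (u n) *\<^sub>R (u n - (u n $ m) *\<^sub>R 1)" for n
  define Q where "Q n i = (sgn (u n) $ i)\<^sup>2 + sgn (u n) $ i * sgn (u n) $ m + (sgn (u n) $ m)\<^sup>2" for n i
  have Q: "(\<lambda>n. Q n i) \<longlonglongrightarrow> 3 * k\<^sup>2" for i
  proof -
    have "(\<lambda>n. Q n i) \<longlonglongrightarrow> (w $ i)\<^sup>2 + w $ i * w $ m + (w $ m)\<^sup>2"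
      unfolding Q_def u_def by (intro tendsto_intros tendsto_vec_nth s)
    then show ?thesis
      by (simp add: w_eq power2_eq_square)
  qed
  have tQ: "t n $ i * Q n i = g n $ i" for n i
  proof (cases "norm (u n) = 0")
    case False
    then show ?thesis
      by (simp add: t_def Q_def g_def sgn_div_norm vec_power_nth field_simps power2_eq_square power3_eq_cube)
  qed (simp add: t_def g_def)
  have t: "t \<longlonglongrightarrow> (1 / (3 * k\<^sup>2)) *\<^sub>R q"
  proof (rule vec_tendstoI)
    fix i
    have "\<forall>\<^sub>F n in sequentially. Q n i \<noteq> 0"
      using tendsto_imp_eventually_ne[OF Q] k by simp
    then have "\<forall>\<^sub>F n in sequentially. g n $ i / Q n i = t n $ i"
      by (rule eventually_mono) (simp flip: tQ)
    moreover have "(\<lambda>n. g n $ i / Q n i) \<longlonglongrightarrow> q $ i / (3 * k\<^sup>2)"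
      using k by (intro tendsto_divide tendsto_vec_nth g Q) simp
    ultimately show "(\<lambda>n. t n $ i) \<longlonglongrightarrow> ((1 / (3 * k\<^sup>2)) *\<^sub>R q) $ i"
      by (simp add: tendsto_cong)
  qed
  have "t n \<in> mat_im A" for n
    unfolding t_def
    by (intro subspace_scale subspace_diff subspace_mat_im im1) (simp add: u_def mat_im_def)
  then have "(1 / (3 * k\<^sup>2)) *\<^sub>R q \<in> mat_im A"
    by (rule closed_sequentially[OF closed_subspace[OF subspace_mat_im] _ t])
  \<comment> \<open>The scalar turns q / (3 k^2) into - q / k, which \<open>A\<close> sends to w / k
    = 1.\<close>
  then have "(- 3 * k) *\<^sub>R ((1 / (3 * k\<^sup>2)) *\<^sub>R q) \<in> mat_im A"
    by (rule subspace_scale[OF subspace_mat_im])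
  then have "(- 1 / k) *\<^sub>R q \<in> mat_im A"
    using k by (simp add: power2_eq_square)
  moreover have "A *v ((- 1 / k) *\<^sub>R q) = 1"
    unfolding matrix_vector_mult_scaleR Aq w_eq using k by simp
  ultimately have "1 \<in> mat_im (A ** (A ** transpose A))"
    unfolding mat_im_mult[of A "A ** transpose A"] mat_im_mult_transpose by (metis imageI)
  then show False
    using notin im1 by (simp add: mat_im_mult_transpose matrix_mul_assoc)
qed

section \<open>Deriving the stated conclusions from properness\<close>

theorem theorem1p19:
  fixes A :: "real^('n::{finite,wellorder})^('n::{finite,wellorder})"
  assumes "\<forall>x. det (jacobian (cubic_map A) (at x)) \<noteq> 0"
  shows
    "(mat_ker A \<subseteq> mat_ker (A ** transpose A) \<longrightarrow> bij (cubic_map A)) \<and>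
     (invertible A \<or> transpose A = A \<or> transpose A = - A \<longrightarrow>
        mat_ker A \<subseteq> mat_ker (A ** transpose A)) \<and>
     (rank (A ** transpose A) = 1 \<longrightarrow> bij (cubic_map A)) \<and>
     (upper_triangular_matrix A \<or> lower_triangular_matrix A \<longrightarrow> bij (cubic_map A)) \<and>
     ((\<exists>D. diagonal_matrix D \<and> invertible D \<and>
           proper_fun (cubic_map (D ** A ** matrix_inv (D ** D ** D)))) \<longrightarrow> bij (cubic_map A)) \<and>
     ((\<exists>\<zeta>. weighted_cubic_nonneg A \<zeta>) \<longrightarrow> bij (cubic_map A)) \<and>
     (mat_ker A = span {1} \<and>
        1 \<notin> mat_im (A ** transpose A) \<inter> mat_im (A ** A ** transpose A) \<longrightarrow>
        bij (cubic_map A)) \<and>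
     ((\<exists>\<zeta>. weighted_cubic_nonneg A \<zeta>) \<longrightarrow> proper_fun (cubic_map A)) \<and>
     ((\<exists>\<zeta>. weighted_cubic_nonneg A \<zeta> \<and>
           (\<forall>x \<in> mat_im (A ** transpose A). x \<noteq> 0 \<longrightarrow> (A *v (x ^ 3)) \<bullet> (\<zeta> * x) \<noteq> 0)) \<longrightarrow>
        proper_fun (cubic_map (- A)))"
proof -
  have nd: "nondegenerate A"
    by (rule nondegenerate_if_det_jacobian[OF assms])
  have bij: "bij (cubic_map A)" if "proper_fun (cubic_map A)"
    by (rule nondegenerate_proper_imp_bij[OF nd that])
  show ?thesis
  proof (intro conjI impI)
    assume "mat_ker A \<subseteq> mat_ker (A ** transpose A)"
    then show "bij (cubic_map A)"
      by (rule bij[OF proper_if_ker_subset])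
  next
    assume "invertible A \<or> transpose A = A \<or> transpose A = - A"
    then show "mat_ker A \<subseteq> mat_ker (A ** transpose A)"
      by (rule ker_subset_ker_mult_transpose)
  next
    assume "rank (A ** transpose A) = 1"
    then show "bij (cubic_map A)"
      by (rule bij[OF proper_if_weighted_cubic_nonneg[OF weighted_cubic_nonneg_if_rank_1[OF nd]]])
  next
    assume "upper_triangular_matrix A \<or> lower_triangular_matrix A"
    then show "bij (cubic_map A)"
      by (rule bij[OF proper_if_triangular[OF assms]])
  next
    assume "\<exists>D. diagonal_matrix D \<and> invertible D \<and>
      proper_fun (cubic_map (D ** A ** matrix_inv (D ** D ** D)))"
    then show "bij (cubic_map A)"
      by (elim exE conjE) (rule bij[OF proper_if_diagonal_conjugate_proper])
  next
    assume "\<exists>\<zeta>. weighted_cubic_nonneg A \<zeta>"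
    then show "bij (cubic_map A)"
      by (elim exE) (rule bij[OF proper_if_weighted_cubic_nonneg])
  next
    assume "mat_ker A = span {1} \<and> 1 \<notin> mat_im (A ** transpose A) \<inter> mat_im (A ** A ** transpose A)"
    then show "bij (cubic_map A)"
      by (elim conjE) (rule bij[OF proper_if_ker_span_1])
  next
    assume "\<exists>\<zeta>. weighted_cubic_nonneg A \<zeta>"
    then show "proper_fun (cubic_map A)"
      by (elim exE) (rule proper_if_weighted_cubic_nonneg)
  next
    assume "\<exists>\<zeta>. weighted_cubic_nonneg A \<zeta> \<and>
      (\<forall>x \<in> mat_im (A ** transpose A). x \<noteq> 0 \<longrightarrow> (A *v (x ^ 3)) \<bullet> (\<zeta> * x) \<noteq> 0)"
    then obtain \<zeta> where "\<forall>x \<in> mat_im (A ** transpose A). x \<noteq> 0 \<longrightarrow> (A *v (x ^ 3)) \<bullet> (\<zeta> * x) \<noteq> 0"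
      by (elim exE conjE)
    then show "proper_fun (cubic_map (- A))"
      by (intro proper_uminus_if_weighted_cubic_nonzero[of A \<zeta>]) blast
  qed
qed

end
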